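(* Let $r, D, \Delta$ be integers with $r\ge 0$ and $\Delta\geq D \geq 2r+2$, and let $X=x_1x_2\cdots x_D$ be a remote vertex of $\Gamma_\Delta(D,-r)$, i.e. a vertex with $x_{D-1}=1$, $x_D=D$, and $x_i>D$ for some $1\leq i\leq D-2$. Then the distance from the vertex $I=12\cdots D$ to $X$ in $\Gamma_\Delta(D,-r)$ equals $D+r$.
   Context: For integers $\Delta\geq D\ge 1$ and $0\le r\le D-1$, the digraph $\Gamma_\Delta(D,-r)$ is defined as follows. Its vertices are the sequences $x_1x_2\cdots x_D$ of $D$ distinct letters from the alphabet $\{1,2,\ldots,\Delta+1\}$. There is an arc from $x_1x_2\cdots x_D$ to each of the following vertices, and to no others: (rotations) $x_k x_1\cdots x_{k-1}x_{k+1}\cdots x_D$ for each $k$ with $r+2\leq k\leq D$; (shifts) $y x_1x_2\cdots x_{D-1}$ for each $y\in\{1,\ldots,\Delta+1\}\setminus\{x_1,\ldots,x_D\}$. The distance from a vertex $X$ to a vertex $Y$ in a digraph is the length (number of arcs) of a shortest directed path from $X$ to $Y$. *)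

theory Defs
  imports "Graph_Theory.Graph_Theory"
begin

(* The vertex x_1 x_2 ... x_D is the list xs with x_i = xs ! (i - 1). *)
definition vertices :: "nat \<Rightarrow> nat \<Rightarrow> nat list set" where
  "vertices \<Delta> D = {xs. length xs = D \<and> distinct xs \<and> set xs \<subseteq> {1..\<Delta> + 1}}"

(* x_k x_1 ... x_(k-1) x_(k+1) ... x_D *)
definition rotation :: "nat \<Rightarrow> nat list \<Rightarrow> nat list" where
  "rotation k xs = xs ! (k - 1) # take (k - 1) xs @ drop k xs"

(* y x_1 ... x_(D-1) *)
definition shift :: "nat \<Rightarrow> nat list \<Rightarrow> nat list" where
  "shift y xs = y # butlast xs"

(* The parameter r is the absolute value of the second argument of Gamma_Delta(D,-r). *)
definition Gam :: "nat \<Rightarrow> nat \<Rightarrow> nat \<Rightarrow> nat list pair_pre_digraph" where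
  "Gam \<Delta> D r =
    \<lparr> pverts = vertices \<Delta> D,
      parcs = {(xs, rotation k xs) | xs k. xs \<in> vertices \<Delta> D \<and> r + 2 \<le> k \<and> k \<le> D}
            \<union> {(xs, shift y xs) | xs y. xs \<in> vertices \<Delta> D \<and> y \<in> {1..\<Delta> + 1} - set xs} \<rparr>"

(* Unit arc weights make the shortest-path cost count arcs; see digraph_dist_eq.
   The value is infinite if v is not reachable from u. *)
definition digraph_dist :: "'a pair_pre_digraph \<Rightarrow> 'a \<Rightarrow> 'a \<Rightarrow> ereal" where
  "digraph_dist G u v = wf_digraph.\<mu> (with_proj G) (\<lambda>_. 1) u v"

(* In the lists' zero-based indexing, x_(D-1) is X ! (D - 2) and x_D is X ! (D - 1). *)
definition remote :: "nat \<Rightarrow> nat \<Rightarrow> nat list \<Rightarrow> bool" where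
  "remote \<Delta> D X \<longleftrightarrow> X \<in> vertices \<Delta> D \<and> X ! (D - 2) = 1 \<and> X ! (D - 1) = D
     \<and> (\<exists>i. 1 \<le> i \<and> i \<le> D - 2 \<and> X ! (i - 1) > D)"

lemma rotation_in_vertices:
  assumes "xs \<in> vertices \<Delta> D" "1 \<le> k" "k \<le> D"
  shows "rotation k xs \<in> vertices \<Delta> D"
proof -
  have len: "length xs = D" using assms by (simp add: vertices_def)
  have eq: "xs = take (k - 1) xs @ xs ! (k - 1) # drop k xs"
    using id_take_nth_drop[of "k - 1" xs] assms len by simp
  have "mset (rotation k xs) = mset xs"
    using arg_cong[OF eq, of mset] by (simp add: rotation_def)
  then have "length (rotation k xs) = length xs" "set (rotation k xs) = set xs"
    "distinct (rotation k xs) = distinct xs"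
    by (metis size_mset, metis set_mset_mset, metis mset_eq_imp_distinct_iff)
  then show ?thesis using assms by (simp add: vertices_def)
qed

lemma shift_in_vertices:
  assumes "xs \<in> vertices \<Delta> D" "1 \<le> D" "y \<in> {1..\<Delta> + 1} - set xs"
  shows "shift y xs \<in> vertices \<Delta> D"
  using assms by (auto simp: vertices_def shift_def distinct_butlast dest: in_set_butlastD)

lemma pair_wf_digraph_Gam:
  assumes "1 \<le> D"
  shows "pair_wf_digraph (Gam \<Delta> D r)"
  using assms
  by unfold_locales (auto simp: Gam_def intro!: rotation_in_vertices shift_in_vertices)

lemma digraph_dist_eq:
  assumes "pair_wf_digraph G"
  shows "digraph_dist G u v =
    (INF p \<in> {p. pre_digraph.awalk (with_proj G) u p v}. ereal (real (length p)))"
proof -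
  interpret pair_wf_digraph G by fact
  have "awalk_cost (\<lambda>_. 1) p = real (length p)" for p :: "('a \<times> 'a) list"
    by (induction p) auto
  moreover have "wf_digraph (with_proj G)" by unfold_locales
  ultimately show ?thesis by (simp add: digraph_dist_def wf_digraph.\<mu>_def)
qed

end

theory Submission
  imports Defs
begin

text \<open>
  An arc moves a letter that is not among the first \<open>r + 1\<close> to the front; the other letters keep
  their order and the last one is dropped if the letter is new. Hence a walk from \<open>I\<close> is a word of
  requested letters, and prepending the requests (latest first) to \<open>I\<close> gives a word in which any
  \<open>r + 2\<close> consecutive letters are distinct.

  Lower bound: as long as 1 is never requested, \<open>D\<close> can stay behind it only if no letter was ever
  dropped, which is incompatible with a letter exceeding \<open>D\<close>. So 1 is requested, at step
  \<open>r + 2\<close> at the earliest, and then needs \<open>D - 2\<close> further steps to get to position \<open>D - 1\<close>.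

  Upper bound: request \<open>r\<close> suitable filler letters, then \<open>D\<close>, \<open>1\<close>, and
  \<open>x_(D-2), \<dots>, x_1\<close>. The fillers exist by a greedy choice because \<open>\<Delta> + 1 \<ge> 2 r + 3\<close>.
\<close>

section \<open>Lower bound\<close>

text \<open>Splitting the word at the moved letter lets \<open>takeWhile\<close> and
  \<open>dropWhile\<close> be computed by append rules; \<open>r + 1 \<le> length P\<close> is
  \<open>r + 2 \<le> k\<close> for the one-based \<open>k\<close>.\<close>

lemma Gam_arc_cases:
  assumes "(s, s') \<in> parcs (Gam \<Delta> D r)" and "1 \<le> D"
  obtains (rotation) P y S where "s = P @ y # S" "s' = y # P @ S" "r + 1 \<le> length P"
  | (shift) P z y where "s = P @ [z]" "s' = y # P" "y \<notin> set s"
proof -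
  from assms have len: "length s = D"
    by (auto simp: Gam_def vertices_def)
  from assms(1) consider k where "s' = rotation k s" "r + 2 \<le> k" "k \<le> D"
    | y where "s' = shift y s" "y \<notin> set s"
    by (auto simp: Gam_def)
  then show thesis
  proof cases
    case 1
    have "s = take (k - 1) s @ s ! (k - 1) # drop k s"
      using id_take_nth_drop[of "k - 1" s] 1 len by simp
    then show ?thesis
      using 1 len by (intro that(1)[of "take (k - 1) s" "s ! (k - 1)" "drop k s"])
        (auto simp: rotation_def)
  next
    case 2
    have "s = butlast s @ [last s]"
      using len assms(2) by (metis append_butlast_last_id list.size(3) not_one_le_zero)
    then show ?thesis
      using 2 by (intro that(2)[of "butlast s" "last s" y]) (auto simp: shift_def)
  qed
qed

text \<open>What holds after \<open>t\<close> steps: the first alternative once 1 has been requested, the second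
  before that. The length is the number of letters in front of 1, and \<open>D\<close> if 1 is absent.\<close>

definition late_one :: "nat \<Rightarrow> nat \<Rightarrow> nat \<Rightarrow> nat list \<Rightarrow> bool" where
  "late_one D r t s \<longleftrightarrow>
     length (takeWhile (\<lambda>x. x \<noteq> 1) s) + r + 2 \<le> t \<or>
     length (takeWhile (\<lambda>x. x \<noteq> 1) s) \<le> t \<and>
       (D \<in> set (dropWhile (\<lambda>x. x \<noteq> 1) s) \<longrightarrow> set s = {1..D} \<and> last s = D)"

text \<open>A request other than 1 adds at most one letter in front of 1 and brings nothing new
  behind it. If \<open>D\<close> is last and survives behind 1, the arc dropped no letter, so the
  letter set and the last letter persist.\<close>

lemma late_one_step:
  assumes arc: "(s, s') \<in> parcs (Gam \<Delta> D r)" and D: "2 \<le> D" and r: "r + 1 \<le> D"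
    and Q: "late_one D r t s"
  shows "late_one D r (Suc t) s'"
proof -
  let ?P = "\<lambda>x::nat. x \<noteq> 1"
  from arc have dist: "distinct s"
    by (auto simp: Gam_def vertices_def)
  have present: "takeWhile ?P (P @ Z) = takeWhile ?P P" "dropWhile ?P (P @ Z) = dropWhile ?P P @ Z"
    if "1 \<in> set P" for P Z
    using that by simp_all
  have absent: "takeWhile ?P (P @ Z) = P @ takeWhile ?P Z" "dropWhile ?P (P @ Z) = dropWhile ?P Z"
    "takeWhile ?P P = P" "dropWhile ?P P = []"
    if "1 \<notin> set P" for P Z
  proof -
    have "\<forall>x\<in>set P. x \<noteq> 1" using that by metis
    then show "takeWhile ?P (P @ Z) = P @ takeWhile ?P Z" "dropWhile ?P (P @ Z) = dropWhile ?P Z"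
      "takeWhile ?P P = P" "dropWhile ?P P = []"
      by (simp_all add: takeWhile_append2 dropWhile_append2 takeWhile_eq_all_conv)
  qed
  have dropD: "x \<in> set xs" if "x \<in> set (dropWhile ?P xs)" for x xs
    using that by (rule set_dropWhileD)
  have L: "length (takeWhile ?P s) \<le> t"
    using Q unfolding late_one_def by linarith
  \<comment> \<open>A request of 1 needs \<open>r + 1\<close> letters in front of it, and by
    \<open>L\<close> at least that many steps are already spent. So the first alternative holds with
    no letter in front of 1.\<close>
  have one: ?thesis if "s' = 1 # xs" "r + 1 \<le> length (takeWhile ?P s)" for xs
    using that L by (simp add: late_one_def)
  have other: ?thesis
    if "length (takeWhile ?P s') \<le> Suc (length (takeWhile ?P s))"
      and "D \<in> set (dropWhile ?P s') \<Longrightarrow>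
        D \<in> set (dropWhile ?P s) \<and> (last s = D \<longrightarrow> set s' = set s \<and> last s' = D)"
    using that Q unfolding late_one_def by auto
  have "1 \<le> D" using D by simp
  with arc show ?thesis
  proof (cases rule: Gam_arc_cases)
    case (rotation P y S)
    show ?thesis
    proof (cases "y = 1")
      case True
      then have "1 \<notin> set P" using rotation dist by auto
      then have "takeWhile ?P s = P"
        using rotation(1) True absent(1) by simp
      then show ?thesis
        using one[of "P @ S"] rotation True by simp
    next
      case False
      show ?thesis
      proof (cases "1 \<in> set P")
        case True
        show ?thesis
        proof (rule other)
          show "length (takeWhile ?P s') \<le> Suc (length (takeWhile ?P s))"
            using False by (simp add: rotation(1,2) present[OF True] del: One_nat_def)
          assume "D \<in> set (dropWhile ?P s')"
          then have D_in: "D \<in> set (dropWhile ?P P) \<union> set S"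
            using False by (simp add: rotation(2) present[OF True] del: One_nat_def)
          \<comment> \<open>By distinctness \<open>D\<close> is not the moved letter, as it occurs
            in \<open>P\<close> or \<open>S\<close>; hence a last letter \<open>D\<close> lies in
            \<open>S\<close> and stays last.\<close>
          then have "y \<noteq> D"
            using dropD[of D P] dist unfolding rotation(1) by force
          then have "S \<noteq> []" if "last s = D"
            using that rotation(1) by force
          then have "last s = D \<longrightarrow> set s' = set s \<and> last s' = D"
            unfolding rotation(1,2) by force
          then show "D \<in> set (dropWhile ?P s) \<and> (last s = D \<longrightarrow> set s' = set s \<and> last s' = D)"
            using D_in by (simp add: rotation(1) present[OF True] del: One_nat_def)
        qed
      next
        case notin: False
        show ?thesis
        proof (rule other)
          show "length (takeWhile ?P s') \<le> Suc (length (takeWhile ?P s))"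
            using False by (simp add: rotation(1,2) absent(1)[OF notin] del: One_nat_def)
          assume "D \<in> set (dropWhile ?P s')"
          then have D_in: "D \<in> set (dropWhile ?P S)"
            using False by (simp add: rotation(2) absent(2)[OF notin] del: One_nat_def)
          then have "S \<noteq> []" by force
          then have "last s = D \<longrightarrow> set s' = set s \<and> last s' = D"
            unfolding rotation(1,2) by force
          then show "D \<in> set (dropWhile ?P s) \<and> (last s = D \<longrightarrow> set s' = set s \<and> last s' = D)"
            using D_in False by (simp add: rotation(1) absent(2)[OF notin] del: One_nat_def)
        qed
      qed
    qed
  next
    case (shift P z y)
    show ?thesis
    proof (cases "y = 1")
      case True
      \<comment> \<open>A shift requests only absent letters, so all \<open>D\<close> letters count
        as standing in front of 1.\<close>
      then have "takeWhile ?P s = s"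
        using shift(3) by (intro absent(3)) simp
      moreover have "length s = D" using arc by (auto simp: Gam_def vertices_def)
      ultimately have "r + 1 \<le> length (takeWhile ?P s)" using r by metis
      then show ?thesis
        using one[of P] True shift(2) by blast
    next
      case False
      show ?thesis
      proof (cases "1 \<in> set P")
        case True
        have "D \<noteq> z" if "D \<in> set (dropWhile ?P P)"
          using dropD[OF that] dist shift(1) by auto
        then show ?thesis
          using False by (intro other) (auto simp: shift(1,2) present[OF True] simp del: One_nat_def)
      next
        case notin: False
        then show ?thesis
          using False by (intro other) (simp_all add: shift(1,2) absent del: One_nat_def)
      qed
    qed
  qed
qed

lemma late_one_walk:
  assumes "pre_digraph.awalk (with_proj (Gam \<Delta> D r)) u p v" and "2 \<le> D" and "r + 1 \<le> D"
    and "late_one D r t u"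
  shows "late_one D r (t + length p) v"
proof -
  interpret pair_wf_digraph "Gam \<Delta> D r"
    using assms(2) by (intro pair_wf_digraph_Gam) simp
  show ?thesis
    using assms
  proof (induction p arbitrary: u t)
    case Nil
    then show ?case by (simp add: awalk_Nil_iff)
  next
    case (Cons e p)
    from Cons.prems(1) have e: "e \<in> parcs (Gam \<Delta> D r)" "fst e = u"
      and walk: "pre_digraph.awalk (with_proj (Gam \<Delta> D r)) (snd e) p v"
      by (auto simp: awalk_Cons_iff)
    have "late_one D r (Suc t) (snd e)"
      using late_one_step[of u "snd e"] e Cons.prems by (metis prod.collapse)
    then show ?case
      using Cons.IH[OF walk Cons.prems(2,3)] by fastforce
  qed
qed

lemma takeWhile_neq_nth:
  assumes "distinct xs" "i < length xs"
  shows "takeWhile (\<lambda>x. x \<noteq> xs ! i) xs = take i xs"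
  using assms by (intro takeWhile_eq_take_P_nth) (auto simp: nth_eq_iff_index_eq)

text \<open>In \<open>X\<close>, \<open>D\<close> stands behind 1 but some letter exceeds
  \<open>D\<close>, which refutes the second alternative of \<open>late_one\<close>. The first one,
  with \<open>D - 2\<close> letters in front of 1, is the bound.\<close>

lemma remote_walk_length:
  assumes "pre_digraph.awalk (with_proj (Gam \<Delta> D r)) [1..<D + 1] p X"
    and "2 \<le> D" and "r + 1 \<le> D" and "remote \<Delta> D X"
  shows "D + r \<le> length p"
proof -
  have X: "length X = D" "distinct X" "X ! (D - 2) = 1" "X ! (D - 1) = D" "\<exists>x\<in>set X. x > D"
    using assms(4) by (auto simp: remote_def vertices_def intro!: bexI[OF _ nth_mem])
  have len: "takeWhile (\<lambda>x. x \<noteq> 1) X = take (D - 2) X"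
    using takeWhile_neq_nth[of X "D - 2"] X assms(2) by auto
  have "dropWhile (\<lambda>x. x \<noteq> 1) X = drop (D - 2) X"
    by (metis append_take_drop_id len same_append_eq takeWhile_dropWhile_id)
  then have "D \<in> set (dropWhile (\<lambda>x. x \<noteq> 1) X)"
    using X assms(2) by (auto simp: in_set_conv_nth intro!: exI[of _ 1])
  moreover have "late_one D r 0 [1..<D + 1]"
    using assms(2) by (auto simp: late_one_def upt_conv_Cons)
  then have "late_one D r (length p) X"
    using late_one_walk[OF assms(1,2,3)] by fastforce
  moreover have "set X \<noteq> {1..D}" using X by fastforce
  ultimately have "length (take (D - 2) X) + r + 2 \<le> length p"
    unfolding late_one_def len by blast
  then show ?thesis
    using X(1) assms(2) by simp
qed

section \<open>Upper bound\<close>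

lemma nth_notin_take_imp:
  assumes "s ! j \<notin> set (take k s)" "j < length s"
  shows "k \<le> j"
  using assms by (metis in_set_conv_nth length_take min_less_iff_conj not_le nth_take)

text \<open>The arc is a rotation if \<open>y\<close> occurs in \<open>s\<close> and a shift
  otherwise. Either way a prefix avoiding \<open>y\<close> moves back one place intact.\<close>

lemma walk_push:
  assumes "pre_digraph.awalk (with_proj (Gam \<Delta> D r)) u p s"
    and D: "1 \<le> D" and y: "y \<in> {1..\<Delta> + 1}" "y \<notin> set (take (r + 1) s)"
  obtains q s' where "pre_digraph.awalk (with_proj (Gam \<Delta> D r)) u q s'" "length q = Suc (length p)"
    "\<And>k. k < D \<Longrightarrow> y \<notin> set (take k s) \<Longrightarrow> take (Suc k) s' = y # take k s"
proof -
  interpret pair_wf_digraph "Gam \<Delta> D r"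
    using D by (rule pair_wf_digraph_Gam)
  have s: "s \<in> vertices \<Delta> D"
    using awalk_last_in_verts[OF assms(1)] assms(1) by (auto simp: Gam_def)
  then have len: "length s = D" by (simp add: vertices_def)
  obtain s' where arc: "(s, s') \<in> parcs (Gam \<Delta> D r)"
    and pre: "\<And>k. k < D \<Longrightarrow> y \<notin> set (take k s) \<Longrightarrow> take (Suc k) s' = y # take k s"
  proof (cases "y \<in> set s")
    case True
    then obtain j where j: "j < D" "s ! j = y"
      using len by (auto simp: in_set_conv_nth)
    have "r + 1 \<le> j"
      using nth_notin_take_imp[of s j] y(2) j len by simp
    then have "(s, rotation (Suc j) s) \<in> parcs (Gam \<Delta> D r)"
      using s j by (auto simp: Gam_def)
    moreover have "take (Suc k) (rotation (Suc j) s) = y # take k s"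
      if "k < D" "y \<notin> set (take k s)" for k
    proof -
      have "k \<le> j"
        using nth_notin_take_imp[of s j] that j len by simp
      then show ?thesis using j len by (simp add: rotation_def min_def)
    qed
    ultimately show ?thesis using that by blast
  next
    case False
    then have "(s, shift y s) \<in> parcs (Gam \<Delta> D r)"
      using s y by (auto simp: Gam_def)
    moreover have "take (Suc k) (shift y s) = y # take k s" if "k < D" for k
      using that len by (simp add: shift_def take_butlast)
    ultimately show ?thesis using that by blast
  qed
  have "awalk s [(s, s')] s'"
    using arc_implies_awalk[of "(s, s')"] arc by simp
  then have "awalk u (p @ [(s, s')]) s'"
    using assms(1) by (rule awalk_appendI[rotated])
  from that[OF this _ pre] show thesis by simp
qed

text \<open>The requests \<open>ws\<close> are listed with the latest one first.\<close>

lemma walk_of_requests: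
  assumes "1 \<le> D" "r + 1 \<le> D" "D \<le> \<Delta> + 1" and "set ws \<subseteq> {1..\<Delta> + 1}"
    and "\<And>i. i < length ws \<Longrightarrow> distinct (take (r + 2) (drop i (ws @ [1..<D + 1])))"
  shows "\<exists>p s. pre_digraph.awalk (with_proj (Gam \<Delta> D r)) [1..<D + 1] p s \<and> length p = length ws
    \<and> (\<forall>k\<le>D. distinct (take k (ws @ [1..<D + 1])) \<longrightarrow> take k s = take k (ws @ [1..<D + 1]))"
  using assms(4,5)
proof (induction ws)
  case Nil
  interpret pair_wf_digraph "Gam \<Delta> D r"
    using assms(1) by (rule pair_wf_digraph_Gam)
  have "[1..<D + 1] \<in> pverts (Gam \<Delta> D r)"
    using assms(3) by (auto simp: Gam_def vertices_def)
  then have "awalk [1..<D + 1] [] [1..<D + 1]" by (simp add: awalk_Nil_iff)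
  then show ?case by (intro exI[of _ "[]"] exI[of _ "[1..<D + 1]"]) simp
next
  case (Cons y ws)
  have win: "distinct (take (r + 2) (drop i (ws @ [1..<D + 1])))" if "i < length ws" for i
    using Cons.prems(2)[of "Suc i"] that by simp
  from Cons.IH[OF _ win] Cons.prems(1) obtain p s
    where walk: "pre_digraph.awalk (with_proj (Gam \<Delta> D r)) [1..<D + 1] p s"
      and len: "length p = length ws"
      and pre: "\<And>k. k \<le> D \<Longrightarrow> distinct (take k (ws @ [1..<D + 1])) \<Longrightarrow>
        take k s = take k (ws @ [1..<D + 1])"
    by auto
  \<comment> \<open>The first window makes the request of \<open>y\<close> legal: its tail is
    distinct, so by induction it is the actual prefix of \<open>s\<close>.\<close>
  have "distinct (y # take (r + 1) (ws @ [1..<D + 1]))"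
    using Cons.prems(2)[of 0] by simp
  then have "y \<notin> set (take (r + 1) s)"
    using pre[OF assms(2)] by simp
  then obtain q s' where q: "pre_digraph.awalk (with_proj (Gam \<Delta> D r)) [1..<D + 1] q s'"
      "length q = Suc (length p)"
    and push: "\<And>k. k < D \<Longrightarrow> y \<notin> set (take k s) \<Longrightarrow> take (Suc k) s' = y # take k s"
    using walk_push[OF walk assms(1), of y] Cons.prems(1) by auto
  have "take k s' = take k ((y # ws) @ [1..<D + 1])"
    if k: "k \<le> D" "distinct (take k ((y # ws) @ [1..<D + 1]))" for k
  proof (cases k)
    case (Suc j)
    then have "take j s = take j (ws @ [1..<D + 1])" "y \<notin> set (take j (ws @ [1..<D + 1]))"
      using k pre[of j] by auto
    then show ?thesis using push[of j] k Suc by simp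
  qed simp
  then show ?case
    using q len by (intro exI[of _ q] exI[of _ s']) auto
qed

text \<open>Greedy choice: the last entry must avoid its forbidden set and the earlier entries,
  together fewer than \<open>card A\<close> letters.\<close>

lemma distinct_choice:
  assumes "finite A" and "\<And>m. m < n \<Longrightarrow> finite (F m) \<and> card (F m) + n \<le> card A"
  shows "\<exists>ys. length ys = n \<and> distinct ys \<and> set ys \<subseteq> A \<and> (\<forall>m<n. ys ! m \<notin> F m)"
  using assms(2)
proof (induction n)
  case 0
  then show ?case by simp
next
  case (Suc n)
  have "finite (F m) \<and> card (F m) + n \<le> card A" if "m < n" for m
    using Suc.prems[of m] that by simp
  then obtain ys where ys: "length ys = n" "distinct ys" "set ys \<subseteq> A" "\<forall>m<n. ys ! m \<notin> F m"
    using Suc.IH by blast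
  have "card (F n \<union> set ys) < card A"
    using Suc.prems[of n] ys card_Un_le[of "F n" "set ys"] by (simp add: distinct_card)
  then have "\<not> A \<subseteq> F n \<union> set ys"
    using Suc.prems[of n] card_mono[of "F n \<union> set ys" A] by auto
  then obtain y where "y \<in> A" "y \<notin> F n" "y \<notin> set ys" by blast
  then show ?case
    using ys by (intro exI[of _ "ys @ [y]"]) (auto simp: nth_append less_Suc_eq)
qed

text \<open>In this form all windows of a word can be checked at once by comparing pairs of
  positions.\<close>

lemma distinct_window_iff:
  "distinct (take k (drop i xs)) \<longleftrightarrow>
    (\<forall>a b. i \<le> a \<and> a < b \<and> b < i + k \<and> b < length xs \<longrightarrow> xs ! a \<noteq> xs ! b)" (is "?L \<longleftrightarrow> ?R")
proof
  assume L: ?L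
  show ?R
  proof (intro allI impI)
    fix a b assume ab: "i \<le> a \<and> a < b \<and> b < i + k \<and> b < length xs"
    then have "take k (drop i xs) ! (a - i) \<noteq> take k (drop i xs) ! (b - i)"
      using L by (subst nth_eq_iff_index_eq) auto
    moreover have "a - i < k" "b - i < k" using ab by linarith+
    ultimately show "xs ! a \<noteq> xs ! b" using ab by simp
  qed
next
  assume R: ?R
  show ?L
    unfolding distinct_conv_nth
  proof (intro allI impI)
    fix a b assume "a < length (take k (drop i xs))" "b < length (take k (drop i xs))" "a \<noteq> b"
    then have "i + a < length xs" "i + b < length xs" "a < k" "b < k" "a < b \<or> b < a"
      by auto
    then show "take k (drop i xs) ! a \<noteq> take k (drop i xs) ! b"
      using R[rule_format, of "i + a" "i + b"] R[rule_format, of "i + b" "i + a"]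
      by auto
  qed
qed

lemma remote_walk_exists:
  assumes "D \<le> \<Delta>" and D: "2 * r + 2 \<le> D" and "remote \<Delta> D X"
  shows "\<exists>p. pre_digraph.awalk (with_proj (Gam \<Delta> D r)) [1..<D + 1] p X \<and> length p = D + r"
proof -
  have X: "length X = D" "distinct X" "X ! (D - 2) = 1" "X ! (D - 1) = D" "set X \<subseteq> {1..\<Delta> + 1}"
    using assms(3) by (auto simp: remote_def vertices_def)
  \<comment> \<open>the letters of \<open>X\<close> and of \<open>I\<close> within distance \<open>r + 1\<close> of the \<open>m\<close>-th filler in the word \<open>W\<close> below\<close>
  define F where "F m = set (drop (D + m - r - 1) X) \<union> {1..m + 2}" for m
  have "card (F m) + r \<le> card {1..\<Delta> + 1}" if "m < r" for m
  proof -
    have "card (F m) \<le> card (set (drop (D + m - r - 1) X)) + card {1..m + 2}"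
      unfolding F_def by (rule card_Un_le)
    \<comment> \<open>The sum is \<open>r + 3\<close>; with \<open>r\<close> fillers this gives
      \<open>2 * r + 3\<close>, at most \<open>D + 1\<close> and so at most
      \<open>\<Delta> + 1\<close>.\<close>
    also have "\<dots> \<le> (r + 1 - m) + (m + 2)"
      using card_length[of "drop (D + m - r - 1) X"] X that D by simp
    finally show ?thesis using that D assms(1) by simp
  qed
  then obtain ys where ys: "length ys = r" "distinct ys" "set ys \<subseteq> {1..\<Delta> + 1}"
    "\<And>m. m < r \<Longrightarrow> ys ! m \<notin> F m"
    using distinct_choice[of "{1..\<Delta> + 1}" r F] by (auto simp: F_def)
  \<comment> \<open>Latest request first: \<open>X\<close> is requested backwards after the
    \<open>r\<close> fillers, \<open>D + r\<close> requests in all.\<close>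
  define W where "W = (X @ ys) @ [1..<D + 1]"
  have W: "W ! a = (if a < D then X ! a else if a < D + r then ys ! (a - D) else a - D - r + 1)"
    if "a < D + r + D" for a
    using that X ys by (auto simp: W_def nth_append simp del: upt_Suc)
  have sep: "W ! a \<noteq> W ! b" if ab: "a < b" "b < a + (r + 2)" "b < D + r + D" for a b
  proof -
    consider "b < D" | "a < D" "D \<le> b" "b < D + r" | "a < D" "D + r \<le> b"
      | "D \<le> a" "b < D + r" | "D \<le> a" "a < D + r" "D + r \<le> b" | "D + r \<le> a"
      by linarith
    then show ?thesis
    proof cases
      case 1
      then show ?thesis using W ab X by (simp add: nth_eq_iff_index_eq)
    next
      case 2
      have "X ! a \<in> set (drop (D + (b - D) - r - 1) X)"
        using nth_mem[of "a - (D + (b - D) - r - 1)" "drop (D + (b - D) - r - 1) X"] 2 ab X by simp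
      then show ?thesis using ys(4)[of "b - D"] 2 W ab by (auto simp: F_def)
    next
      case 3
      \<comment> \<open>Only the extreme pair of a window can straddle all \<open>r\<close> fillers:
        the last letter \<open>D\<close> of \<open>X\<close> and the first letter 1 of
        \<open>I\<close>.\<close>
      then have "a = D - 1" "b = D + r" using ab by linarith+
      then show ?thesis using W ab X D by simp
    next
      case 4
      then show ?thesis using W ab ys by (simp add: nth_eq_iff_index_eq)
    next
      case 5
      then have "b - D - r + 1 \<in> {1..(a - D) + 2}" "a - D < r" using ab by auto
      then show ?thesis using ys(4)[of "a - D"] 5 W ab by (auto simp: F_def)
    next
      case 6
      then show ?thesis using W ab by simp
    qed
  qed
  have "distinct (take (r + 2) (drop i W))" for i
    unfolding distinct_window_iff using sep X ys by (auto simp: W_def)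
  moreover have "1 \<le> D" "r + 1 \<le> D" "D \<le> \<Delta> + 1" "set (X @ ys) \<subseteq> {1..\<Delta> + 1}"
    using X ys D assms(1) by simp_all
  ultimately obtain p s where p: "pre_digraph.awalk (with_proj (Gam \<Delta> D r)) [1..<D + 1] p s"
    "length p = D + r" and pre: "distinct (take D W) \<longrightarrow> take D s = take D W"
    using walk_of_requests[of D r \<Delta> "X @ ys", folded W_def] X(1) ys(1)
    by (metis length_append order_refl)
  interpret pair_wf_digraph "Gam \<Delta> D r"
    using D by (intro pair_wf_digraph_Gam) simp
  have "s \<in> vertices \<Delta> D"
    using awalk_last_in_verts[OF p(1)] p(1) by (auto simp: Gam_def)
  moreover have "take D W = X" using X by (simp add: W_def)
  ultimately have "s = X" using pre X by (simp add: vertices_def)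
  then show ?thesis using p by blast
qed

theorem theorem3p4:
  fixes r D \<Delta> :: nat and X :: "nat list"
  assumes "\<Delta> \<ge> D" and "D \<ge> 2 * r + 2" and "remote \<Delta> D X"
  shows "digraph_dist (Gam \<Delta> D r) [1..<D + 1] X = ereal (real (D + r))"
proof -
  have D: "2 \<le> D" and r: "r + 1 \<le> D" using assms(2) by simp_all
  obtain p where p: "pre_digraph.awalk (with_proj (Gam \<Delta> D r)) [1..<D + 1] p X" "length p = D + r"
    using remote_walk_exists[OF assms] by blast
  have "pair_wf_digraph (Gam \<Delta> D r)"
    using D by (intro pair_wf_digraph_Gam) simp
  note dist_eq = digraph_dist_eq[OF this]
  show ?thesis
    unfolding dist_eq
  proof (intro antisym)
    show "(INF p\<in>{p. pre_digraph.awalk (with_proj (Gam \<Delta> D r)) [1..<D + 1] p X}. ereal (real (length p)))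
        \<le> ereal (real (D + r))"
      using p by (intro INF_lower2[of p]) auto
    show "ereal (real (D + r))
        \<le> (INF p\<in>{p. pre_digraph.awalk (with_proj (Gam \<Delta> D r)) [1..<D + 1] p X}. ereal (real (length p)))"
      using remote_walk_length[OF _ D r assms(3)]
      by (intro INF_greatest) (simp del: upt_Suc of_nat_add)
  qed
qed

end
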